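(* Let $k$ be a field of characteristic zero. For every positive integer $N$ there exists a level algebra $A=k[x_1,x_2,x_3]/I$ of codimension 3 whose $h$-vector has exactly $N$ maxima. In particular, for every positive integer $m$ there exist a positive integer $t$ and a level algebra of codimension 3 over $k$ whose $h$-vector ends with the sequence $t,t,t+1$ repeated $m$ times, i.e. is of the form $(\dots,t,t,t+1,t,t,t+1,\dots,t,t,t+1)$.
   Context: A standard graded artinian algebra is $A=R/I$, where $R=k[x_1,\dots,x_r]$ with all $x_i$ of degree 1 and $I$ is a homogeneous ideal of $R$ containing no non-zero forms of degree at most 1, such that $\dim_k A<\infty$. The $h$-vector of $A$ is $(h_0,h_1,\dots,h_e)$, where $h_i=\dim_k A_i$ and $e$ is the last index with $\dim_k A_e>0$; $e$ is the socle degree of $A$. The codimension of $A$ is $r=h_1$. The socle of $A$ is $\mathrm{soc}(A)=\{a\in A : a\,\overline{m}=0\}$, where $\overline{m}=(\overline{x_1},\dots,\overline{x_r})\subseteq A$; it is a homogeneous ideal. $A$ is level if $\mathrm{soc}(A)_i=0$ for all $i<e$ (equivalently $\mathrm{soc}(A)=A_e$). A maximum of an $h$-vector $(h_0,\dots,h_e)$ is a local maximum in the following sense: a maximal block of consecutive indices $i,i+1,\dots,j$ with $h_i=\dots=h_j$ such that $h_{i-1}<h_i$ if $i>0$, and $h_{j+1}<h_j$ if $j<e$ (so the last entry counts if it is larger than the preceding one). *)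

theory Defs
  imports "HOL-Algebra.Algebraic_Closure_Type" "HOL-Algebra.Embedded_Algebras"
    "HOL-Library.Poly_Mapping" "HOL-Library.Numeral_Type" "HOL-Library.Sublist"
begin

text \<open>
  The polynomial ring over \<open>'k\<close> in variables indexed by the finite type \<open>'n\<close> is the monoid
  algebra of the monoid \<open>'n \<Rightarrow>\<^sub>0 nat\<close> of exponent vectors; the multiplication on
  \<^type>\<open>poly_mapping\<close> is convolution. Taking \<open>'n\<close> to be the three-element type \<open>3\<close> gives
  the polynomial ring in three variables.
\<close>

type_synonym ('n, 'k) mpoly = "('n \<Rightarrow>\<^sub>0 nat) \<Rightarrow>\<^sub>0 'k"

definition mdeg :: "('n::finite \<Rightarrow>\<^sub>0 nat) \<Rightarrow> nat"
  where "mdeg u = (\<Sum>i\<in>UNIV. Poly_Mapping.lookup u i)"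

definition var :: "'n \<Rightarrow> ('n, 'k::field) mpoly"
  where "var i = Poly_Mapping.single (Poly_Mapping.single i 1) 1"

definition const :: "'k \<Rightarrow> ('n, 'k::field) mpoly"
  where "const c = Poly_Mapping.single 0 c"

definition forms :: "nat \<Rightarrow> ('n::finite, 'k::field) mpoly set"
  where "forms d = {f. \<forall>u\<in>Poly_Mapping.keys f. mdeg u = d}"

definition hom_component :: "nat \<Rightarrow> ('n::finite, 'k::field) mpoly \<Rightarrow> ('n, 'k) mpoly"
  where "hom_component d f =
    (\<Sum>u\<in>{u \<in> Poly_Mapping.keys f. mdeg u = d}. Poly_Mapping.single u (Poly_Mapping.lookup f u))"

abbreviation poly_ring :: "('n, 'k::field) mpoly ring"
  where "poly_ring \<equiv> ring_of_type_algebra"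

definition homogeneous_ideal :: "('n::finite, 'k::field) mpoly set \<Rightarrow> bool"
  where "homogeneous_ideal I \<longleftrightarrow>
    ideal I poly_ring \<and> (\<forall>f\<in>I. \<forall>d. hom_component d f \<in> I)"

abbreviation quot_ring :: "('n, 'k::field) mpoly set \<Rightarrow> ('n, 'k) mpoly set ring"
  where "quot_ring I \<equiv> poly_ring Quot I"

definition quot_class :: "('n, 'k::field) mpoly set \<Rightarrow> ('n, 'k) mpoly \<Rightarrow> ('n, 'k) mpoly set"
  where "quot_class I f = I +>\<^bsub>poly_ring\<^esub> f"

text \<open>
  The base field inside the quotient: \<^const>\<open>ring.dim\<close> and \<^const>\<open>ring.finite_dimension\<close>
  measure dimension over a subfield of the ring.
\<close>

definition scalars :: "('n, 'k::field) mpoly set \<Rightarrow> ('n, 'k) mpoly set set"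
  where "scalars I = quot_class I ` range const"

definition graded_part :: "('n::finite, 'k::field) mpoly set \<Rightarrow> nat \<Rightarrow> ('n, 'k) mpoly set set"
  where "graded_part I d = quot_class I ` forms d"

definition std_graded_artinian :: "('n::finite, 'k::field) mpoly set \<Rightarrow> bool"
  where "std_graded_artinian I \<longleftrightarrow>
    homogeneous_ideal I \<and>
    (\<forall>d\<le>1. \<forall>f\<in>I \<inter> forms d. f = 0) \<and>
    ring.finite_dimension (quot_ring I) (scalars I) (carrier (quot_ring I))"

definition hilbert_fun :: "('n::finite, 'k::field) mpoly set \<Rightarrow> nat \<Rightarrow> nat"
  where "hilbert_fun I d = ring.dim (quot_ring I) (scalars I) (graded_part I d)"

definition socle_degree :: "('n::finite, 'k::field) mpoly set \<Rightarrow> nat"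
  where "socle_degree I = (GREATEST d. hilbert_fun I d > 0)"

definition h_vector :: "('n::finite, 'k::field) mpoly set \<Rightarrow> nat list"
  where "h_vector I = map (hilbert_fun I) [0..<Suc (socle_degree I)]"

definition codimension :: "('n::finite, 'k::field) mpoly set \<Rightarrow> nat"
  where "codimension I = hilbert_fun I 1"

definition irrelevant_ideal :: "('n, 'k::field) mpoly set \<Rightarrow> ('n, 'k) mpoly set set"
  where "irrelevant_ideal I = Idl\<^bsub>quot_ring I\<^esub> (quot_class I ` range var)"

definition socle :: "('n, 'k::field) mpoly set \<Rightarrow> ('n, 'k) mpoly set set"
  where "socle I = {a \<in> carrier (quot_ring I).
    \<forall>b\<in>irrelevant_ideal I. a \<otimes>\<^bsub>quot_ring I\<^esub> b = \<zero>\<^bsub>quot_ring I\<^esub>}"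

definition level_algebra :: "('n::finite, 'k::field) mpoly set \<Rightarrow> bool"
  where "level_algebra I \<longleftrightarrow>
    std_graded_artinian I \<and>
    (\<forall>i<socle_degree I. socle I \<inter> graded_part I i = {\<zero>\<^bsub>quot_ring I\<^esub>})"

text \<open>
  A maximum of \<open>(h\<^sub>0, \<dots>, h\<^sub>e)\<close> is recorded as the pair of end points of its block. The strict
  inequalities at both ends already make such a block maximal among constant blocks.
\<close>

definition maxima :: "nat list \<Rightarrow> (nat \<times> nat) set"
  where "maxima h = {(i, j). i \<le> j \<and> j < length h \<and>
    (\<forall>l\<in>{i..j}. h ! l = h ! i) \<and>
    (i > 0 \<longrightarrow> h ! (i - 1) < h ! i) \<and>
    (Suc j < length h \<longrightarrow> h ! Suc j < h ! j)}"

end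

theory Submission
  imports Defs
begin

text \<open>
  All algebras are quotients by monomial ideals. If \<open>M\<close> is a finite set of monomials closed under
  divisors, the monomials outside \<open>M\<close> span an ideal whose \<open>h\<close>-vector counts \<open>M\<close> by degree, and
  the quotient is level as soon as every element of \<open>M\<close> below the top degree \<open>e\<close> divides a larger
  one. Let \<open>M\<close> be the union of a staircase in \<open>x, y\<close> with \<open>z\<close> free and the divisors of one
  further monomial of degree \<open>e\<close>. Descending from degree \<open>e\<close>, the staircase loses
  \<open>3, 3, 3, 6, 6, 6, 9, 9, 9, \<dots>\<close> monomials while the divisors of the extra monomial
  contribute \<open>2, 3, 4, 5, 6, 7, 8, 9, 10, \<dots>\<close> new ones. The differences \<open>-1, 0, 1\<close> repeat, so
  that the \<open>h\<close>-vector ends in \<open>t, t, t + 1\<close> repeated; before that it does not decrease.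
\<close>

subsection \<open>Quotients by monomial ideals\<close>

lemma poly_ring_simps [simp]:
  "carrier (ring_of_type_algebra :: 'a::comm_ring_1 ring) = UNIV"
  "x \<oplus>\<^bsub>(ring_of_type_algebra :: 'a ring)\<^esub> y = x + y"
  "x \<otimes>\<^bsub>(ring_of_type_algebra :: 'a ring)\<^esub> y = x * y"
  "\<zero>\<^bsub>(ring_of_type_algebra :: 'a ring)\<^esub> = 0"
  "\<one>\<^bsub>(ring_of_type_algebra :: 'a ring)\<^esub> = 1"
  by (simp_all add: ring_of_type_algebra_def)

definition restrict_keys :: "('n \<Rightarrow>\<^sub>0 nat) set \<Rightarrow> ('n, 'k::field) mpoly \<Rightarrow> ('n, 'k) mpoly"
  where "restrict_keys S f =
    (\<Sum>u\<in>{u \<in> Poly_Mapping.keys f. u \<in> S}. Poly_Mapping.single u (Poly_Mapping.lookup f u))"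

lemma lookup_restrict_keys:
  "Poly_Mapping.lookup (restrict_keys S f) u = (if u \<in> S then Poly_Mapping.lookup f u else 0)"
  unfolding restrict_keys_def
  by (auto simp: lookup_sum lookup_single when_def sum.delta' in_keys_iff)

lemma hom_component_eq_restrict_keys: "hom_component d f = restrict_keys {u. mdeg u = d} f"
  by (simp add: hom_component_def restrict_keys_def)

text \<open>Describing the ideal by vanishing coefficients, not by generators, lets membership and
  homogeneity be checked one coefficient at a time.\<close>

definition monomial_complement_ideal :: "('n \<Rightarrow>\<^sub>0 nat) set \<Rightarrow> ('n, 'k::field) mpoly set"
  where "monomial_complement_ideal M = {f. \<forall>u\<in>M. Poly_Mapping.lookup f u = 0}"

locale finite_order_ideal =
  fixes M :: "('n::finite \<Rightarrow>\<^sub>0 nat) set"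
  assumes finite_M [simp]: "finite M"
    and down_closed: "u + v \<in> M \<Longrightarrow> u \<in> M"
begin

abbreviation I :: "('n, 'k::field) mpoly set"
  where "I \<equiv> monomial_complement_ideal M"

text \<open>Each monomial of \<open>f * g\<close> is a multiple \<open>a + b\<close> of a monomial
  \<open>a\<close> of \<open>f\<close>. If \<open>a + b\<close> lies in \<open>M\<close>, closure
  under divisors puts \<open>a\<close> in \<open>M\<close>, where \<open>f\<close> has no
  terms.\<close>

lemma lookup_mult_eq_0:
  fixes f g :: "('n, 'k::field) mpoly"
  assumes "f \<in> I" "u \<in> M"
  shows "Poly_Mapping.lookup (f * g) u = 0"
proof (rule ccontr)
  assume "Poly_Mapping.lookup (f * g) u \<noteq> 0"
  then obtain a b where "u = a + b" "a \<in> Poly_Mapping.keys f"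
    using keys_mult[of f g] by (auto simp: in_keys_iff)
  then show False
    using assms down_closed[of a b] by (auto simp: monomial_complement_ideal_def in_keys_iff)
qed

lemma ideal_I: "ideal (I :: ('n, 'k::field) mpoly set) poly_ring"
proof (rule idealI)
  show "ring (poly_ring :: ('n, 'k) mpoly ring)" by (rule ring_from_type_algebra)
  then interpret R: ring "poly_ring :: ('n, 'k) mpoly ring" .
  have minus: "\<ominus>\<^bsub>poly_ring\<^esub> f = - f" for f :: "('n, 'k) mpoly"
    using R.minus_equality[of "- f" f] by simp
  show "subgroup (I :: ('n, 'k) mpoly set) (add_monoid poly_ring)"
    by (rule R.add.subgroupI)
      (auto simp: monomial_complement_ideal_def lookup_add minus a_inv_def[symmetric] intro: exI[of _ 0])
qed (use lookup_mult_eq_0 in \<open>auto simp: monomial_complement_ideal_def mult.commute\<close>)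

lemma homogeneous_I: "homogeneous_ideal (I :: ('n, 'k::field) mpoly set)"
  unfolding homogeneous_ideal_def hom_component_eq_restrict_keys
  by (intro conjI ideal_I) (auto simp: monomial_complement_ideal_def lookup_restrict_keys)

lemma quot_class_ring_hom:
  "quot_class I \<in> ring_hom (poly_ring :: ('n, 'k::field) mpoly ring) (quot_ring I)"
  using ideal.rcos_ring_hom[OF ideal_I] unfolding quot_class_def[abs_def] .

lemma quot_class_add:
  "quot_class I f \<oplus>\<^bsub>quot_ring I\<^esub> quot_class I g = quot_class I (f + g)"
  for f g :: "('n, 'k::field) mpoly"
  using ring_hom_add[OF quot_class_ring_hom, of f g] by simp

lemma quot_class_mult:
  "quot_class I f \<otimes>\<^bsub>quot_ring I\<^esub> quot_class I g = quot_class I (f * g)"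
  for f g :: "('n, 'k::field) mpoly"
  using ring_hom_mult[OF quot_class_ring_hom, of f g] by simp

text \<open>The monomials in \<open>M\<close> represent a basis of the quotient. Through this
  criterion, later arguments about classes become comparisons of coefficients on
  \<open>M\<close>.\<close>

lemma quot_class_eq_iff:
  "quot_class I f = quot_class I g \<longleftrightarrow> (\<forall>u\<in>M. Poly_Mapping.lookup f u = Poly_Mapping.lookup g u)"
  for f g :: "('n, 'k::field) mpoly"
proof -
  have image: "quot_class I h = (\<lambda>a. a + h) ` I" for h :: "('n, 'k) mpoly"
    by (auto simp: quot_class_def a_r_coset_def r_coset_def)
  show ?thesis
  proof
    assume "quot_class I f = quot_class I g"
    moreover have "f \<in> quot_class I f"
      unfolding image by (auto simp: monomial_complement_ideal_def image_iff intro: bexI[of _ 0])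
    ultimately obtain a where "a \<in> I" "f = a + g" unfolding image by auto
    then show "\<forall>u\<in>M. Poly_Mapping.lookup f u = Poly_Mapping.lookup g u"
      by (simp add: monomial_complement_ideal_def lookup_add)
  next
    have incl: "quot_class I f \<subseteq> quot_class I g"
      if "\<forall>u\<in>M. Poly_Mapping.lookup f u = Poly_Mapping.lookup g u" for f g :: "('n, 'k) mpoly"
    proof
      fix x assume "x \<in> quot_class I f"
      then obtain a where "a \<in> I" "x = a + f" unfolding image by auto
      then have "x = (a + f - g) + g" "a + f - g \<in> I"
        using that by (auto simp: monomial_complement_ideal_def lookup_add lookup_minus)
      then show "x \<in> quot_class I g" unfolding image by blast
    qed
    assume "\<forall>u\<in>M. Poly_Mapping.lookup f u = Poly_Mapping.lookup g u"
    then show "quot_class I f = quot_class I g"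
      using incl[of f g] incl[of g f] by auto
  qed
qed

lemma zero_quot_ring: "\<zero>\<^bsub>quot_ring I\<^esub> = quot_class I (0 :: ('n, 'k::field) mpoly)"
  using ring_hom_zero[OF quot_class_ring_hom] ideal.quotient_is_ring[OF ideal_I]
    ring_from_type_algebra by fastforce

lemma carrier_quot_ring:
  "carrier (quot_ring I) = quot_class I ` (UNIV :: ('n, 'k::field) mpoly set)"
  by (auto simp: FactRing_def A_RCOSETS_def RCOSETS_def quot_class_def a_r_coset_def)

lemma quot_class_restrict_keys:
  "quot_class I (restrict_keys M f) = quot_class I (f :: ('n, 'k::field) mpoly)"
  by (simp add: quot_class_eq_iff lookup_restrict_keys)

section \<open>Dimensions over the base field and the level property\<close>

lemma subfield_scalars:
  assumes "M \<noteq> {}"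
  shows "subfield (scalars I) (quot_ring (I :: ('n, 'k::field) mpoly set))"
proof -
  obtain u where "u \<in> M" using assms by auto
  \<comment> \<open>The monomial 1 lies in \<open>M\<close>, so the quotient is not the zero ring
    and the image of the base field is a subfield.\<close>
  then have M0: "0 \<in> M" using down_closed[of 0 u] by simp
  define h where "h = quot_class I \<circ> (const :: 'k \<Rightarrow> ('n, 'k) mpoly)"
  interpret F: field "ring_of_type_algebra :: 'k ring" by (rule field_from_type_algebra)
  interpret R: ring "poly_ring :: ('n, 'k) mpoly ring" by (rule ring_from_type_algebra)
  interpret Q: ring "quot_ring (I :: ('n, 'k) mpoly set)"
    by (rule ideal.quotient_is_ring[OF ideal_I])
  have "(const :: 'k \<Rightarrow> ('n, 'k) mpoly) \<in> ring_hom ring_of_type_algebra poly_ring"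
    by (rule ring_hom_memI) (simp_all add: const_def mult_single single_add)
  then have "h \<in> ring_hom ring_of_type_algebra (quot_ring I)"
    unfolding h_def by (rule ring_hom_trans[OF _ quot_class_ring_hom])
  then have "ring_hom_ring (ring_of_type_algebra :: 'k ring) (quot_ring I) h"
    by (intro ring_hom_ringI2) (unfold_locales)
  moreover have "quot_class I (1 :: ('n, 'k) mpoly) = \<one>\<^bsub>quot_ring I\<^esub>"
    using ring_hom_one[OF quot_class_ring_hom] by simp
  then have "\<one>\<^bsub>quot_ring (I :: ('n, 'k) mpoly set)\<^esub> \<noteq> \<zero>\<^bsub>quot_ring I\<^esub>"
    using M0 by (metis lookup_one_zero lookup_zero quot_class_eq_iff zero_neq_one zero_quot_ring)
  ultimately have "subfield (h ` carrier ring_of_type_algebra) (quot_ring I)"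
    by (rule ring_hom_ring.img_is_subfield(2)[OF _ F.carrier_is_subfield])
  then show ?thesis
    by (simp add: scalars_def h_def image_comp)
qed

text \<open>The induction on \<open>S\<close> follows the inductive definition of
  \<open>dimension\<close>: adjoining \<open>u\<close> is a line extension by the class of
  \<open>u\<close>. That class is new because its coefficient at \<open>u\<close> is 1, while
  polynomials supported on \<open>S\<close> have coefficient 0 there.\<close>

lemma dimension_span_monomials:
  assumes "finite S" "S \<subseteq> M"
  shows "ring.dimension (quot_ring I) (card S) (scalars I)
    (quot_class I ` {f :: ('n, 'k::field) mpoly. Poly_Mapping.keys f \<subseteq> S})"
  using assms
proof (induction S rule: finite_induct)
  case empty
  interpret Q: ring "quot_ring (I :: ('n, 'k) mpoly set)"
    by (rule ideal.quotient_is_ring[OF ideal_I])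
  have "{f :: ('n, 'k) mpoly. Poly_Mapping.keys f \<subseteq> {}} = {0}" by auto
  then show ?case
    using Q.zero_dim by (simp add: zero_quot_ring)
next
  case (insert u S)
  interpret Q: ring "quot_ring (I :: ('n, 'k) mpoly set)"
    by (rule ideal.quotient_is_ring[OF ideal_I])
  let ?V = "\<lambda>S. quot_class I ` {f :: ('n, 'k) mpoly. Poly_Mapping.keys f \<subseteq> S}"
  let ?v = "quot_class I (Poly_Mapping.single u 1 :: ('n, 'k) mpoly)"
  have "?v \<notin> ?V S"
  proof
    assume "?v \<in> ?V S"
    then obtain f :: "('n, 'k) mpoly"
      where "Poly_Mapping.keys f \<subseteq> S" "?v = quot_class I f" by auto
    then have "Poly_Mapping.lookup f u = 1"
      using insert.prems by (auto simp: quot_class_eq_iff)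
    with \<open>Poly_Mapping.keys f \<subseteq> S\<close> \<open>u \<notin> S\<close> show False
      by (auto simp: in_keys_iff subset_iff)
  qed
  moreover have "?V (insert u S) = Q.line_extension (scalars I) ?v (?V S)"
  proof (intro equalityI subsetI)
    fix x assume "x \<in> ?V (insert u S)"
    then obtain f :: "('n, 'k) mpoly"
      where f: "Poly_Mapping.keys f \<subseteq> insert u S" "x = quot_class I f" by auto
    define g where "g = f - Poly_Mapping.single u (Poly_Mapping.lookup f u)"
    have "Poly_Mapping.keys g \<subseteq> S"
      using f(1) by (auto simp: g_def in_keys_iff lookup_minus lookup_single when_def split: if_splits)
    moreover have "f = const (Poly_Mapping.lookup f u) * Poly_Mapping.single u 1 + g"
      by (simp add: g_def const_def mult_single)
    ultimately show "x \<in> Q.line_extension (scalars I) ?v (?V S)"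
      unfolding Q.line_extension_mem_iff f(2) scalars_def
      by (metis (mono_tags, lifting) imageI mem_Collect_eq quot_class_add quot_class_mult rangeI)
  next
    fix x assume "x \<in> Q.line_extension (scalars I) ?v (?V S)"
    then obtain c and g :: "('n, 'k) mpoly" where "Poly_Mapping.keys g \<subseteq> S"
      "x = quot_class I (const c) \<otimes>\<^bsub>quot_ring I\<^esub> ?v \<oplus>\<^bsub>quot_ring I\<^esub> quot_class I g"
      unfolding Q.line_extension_mem_iff scalars_def by auto
    moreover from this have "Poly_Mapping.keys (const c * Poly_Mapping.single u 1 + g) \<subseteq> insert u S"
      by (auto simp: const_def mult_single in_keys_iff lookup_add lookup_single when_def
          split: if_splits)
    ultimately show "x \<in> ?V (insert u S)"
      by (auto simp: quot_class_add quot_class_mult)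
  qed
  ultimately show ?case
    using Q.Suc_dim[of ?v "?V S" "card S" "scalars I"] insert
    by (simp add: carrier_quot_ring)
qed

text \<open>Discarding the terms outside \<open>M\<close> does not change the class of a form; this
  brings graded parts into the shape of \<open>dimension_span_monomials\<close>.\<close>

lemma graded_part_I:
  "graded_part I d = quot_class I `
    {f :: ('n, 'k::field) mpoly. Poly_Mapping.keys f \<subseteq> {u \<in> M. mdeg u = d}}"
  (is "_ = ?rhs")
proof
  show "graded_part I d \<subseteq> ?rhs"
  proof
    fix x :: "('n, 'k) mpoly set" assume "x \<in> graded_part I d"
    then obtain f where f: "f \<in> forms d" "x = quot_class I f" by (auto simp: graded_part_def)
    then have "x = quot_class I (restrict_keys M f)" by (simp add: quot_class_restrict_keys)
    moreover have "Poly_Mapping.keys (restrict_keys M f) \<subseteq> {u \<in> M. mdeg u = d}"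
      using f(1) by (auto simp: forms_def in_keys_iff lookup_restrict_keys split: if_splits)
    ultimately show "x \<in> ?rhs" by blast
  qed
  show "?rhs \<subseteq> graded_part I d" by (auto simp: graded_part_def forms_def)
qed

lemma hilbert_fun_I:
  assumes "M \<noteq> {}"
  shows "hilbert_fun (I :: ('n, 'k::field) mpoly set) d = card {u \<in> M. mdeg u = d}"
proof -
  interpret Q: ring "quot_ring (I :: ('n, 'k) mpoly set)"
    by (rule ideal.quotient_is_ring[OF ideal_I])
  show ?thesis
    using Q.dimI[OF subfield_scalars[OF assms] dimension_span_monomials[of "{u \<in> M. mdeg u = d}"]]
    by (simp add: hilbert_fun_def over_def graded_part_I)
qed

lemma std_graded_artinian_I:
  assumes "\<And>u. mdeg u \<le> 1 \<Longrightarrow> u \<in> M"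
  shows "std_graded_artinian (I :: ('n, 'k::field) mpoly set)"
  unfolding std_graded_artinian_def
proof (intro conjI allI impI ballI homogeneous_I)
  fix d :: nat and f :: "('n, 'k) mpoly"
  assume "d \<le> 1" "f \<in> I \<inter> forms d"
  then show "f = 0"
    using assms by (intro poly_mapping_eqI) 
      (fastforce simp: forms_def monomial_complement_ideal_def in_keys_iff)
next
  interpret Q: ring "quot_ring (I :: ('n, 'k) mpoly set)"
    by (rule ideal.quotient_is_ring[OF ideal_I])
  have "x \<in> quot_class I ` {f :: ('n, 'k) mpoly. Poly_Mapping.keys f \<subseteq> M}"
    if "x \<in> carrier (quot_ring I)" for x
  proof -
    from that obtain f where "x = quot_class I (f :: ('n, 'k) mpoly)"
      by (auto simp: carrier_quot_ring)
    then have "x = quot_class I (restrict_keys M f)" by (simp add: quot_class_restrict_keys)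
    moreover have "Poly_Mapping.keys (restrict_keys M f) \<subseteq> M"
      by (auto simp: in_keys_iff lookup_restrict_keys split: if_splits)
    ultimately show ?thesis by blast
  qed
  then have "carrier (quot_ring I) =
      quot_class I ` {f :: ('n, 'k) mpoly. Poly_Mapping.keys f \<subseteq> M}"
    by (auto simp: carrier_quot_ring)
  then show "Q.finite_dimension (scalars I) (carrier (quot_ring I))"
    using Q.finite_dimensionI[OF dimension_span_monomials[of M]] by simp
qed

text \<open>Let \<open>u\<close> be a monomial in the reduced representative of a socle element
  below the socle degree. Some variable keeps \<open>u\<close> inside \<open>M\<close>, and
  multiplication by a variable is injective on monomials, so the coefficient of \<open>u\<close>
  survives in a product that must be zero.\<close>

lemma level_algebra_I:
  assumes low: "\<And>u. mdeg u \<le> 1 \<Longrightarrow> u \<in> M"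
    and extend: "\<And>u. u \<in> M \<Longrightarrow> mdeg u < socle_degree (I :: ('n, 'k::field) mpoly set) \<Longrightarrow>
      \<exists>i. u + Poly_Mapping.single i 1 \<in> M"
  shows "level_algebra (I :: ('n, 'k) mpoly set)"
  unfolding level_algebra_def
proof (intro conjI allI impI std_graded_artinian_I low)
  fix d assume d: "d < socle_degree (I :: ('n, 'k) mpoly set)"
  interpret Q: ring "quot_ring (I :: ('n, 'k) mpoly set)"
    by (rule ideal.quotient_is_ring[OF ideal_I])
  have "a = \<zero>\<^bsub>quot_ring I\<^esub>"
    if "a \<in> socle (I :: ('n, 'k) mpoly set)" "a \<in> graded_part I d" for a
  proof -
    obtain f :: "('n, 'k) mpoly"
      where f: "Poly_Mapping.keys f \<subseteq> {u \<in> M. mdeg u = d}" "a = quot_class I f"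
      using \<open>a \<in> graded_part I d\<close> by (auto simp: graded_part_I)
    have "Poly_Mapping.keys f = {}"
    proof (rule ccontr)
      assume "Poly_Mapping.keys f \<noteq> {}"
      then obtain u where u: "u \<in> Poly_Mapping.keys f" by blast
      then obtain i where i: "u + Poly_Mapping.single i 1 \<in> M"
        using f(1) d extend[of u] by auto
      have "quot_class I (var i) \<in> irrelevant_ideal (I :: ('n, 'k) mpoly set)"
        unfolding irrelevant_ideal_def using Q.genideal_self[of "quot_class I ` range var"]
        by (auto simp: carrier_quot_ring)
      then have "quot_class I (f * var i) = quot_class I 0"
        using \<open>a \<in> socle I\<close> by (auto simp: socle_def f(2) quot_class_mult[symmetric] zero_quot_ring)
      then have zero: "Poly_Mapping.lookup (f * var i) (u + Poly_Mapping.single i 1) = 0"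
        using i by (simp add: quot_class_eq_iff)
      \<comment> \<open>By cancellation of exponents, only the term at \<open>u\<close> reaches the
        monomial \<open>u + Poly_Mapping.single i 1\<close>; the rest \<open>g\<close> contributes
        nothing there.\<close>
      define g where "g = restrict_keys (- {u}) f"
      have "f = Poly_Mapping.single u (Poly_Mapping.lookup f u) + g"
        by (rule poly_mapping_eqI)
          (auto simp: g_def lookup_add lookup_single lookup_restrict_keys when_def)
      then have "f * var i = (Poly_Mapping.single u (Poly_Mapping.lookup f u) + g) * var i"
        by (rule arg_cong)
      also have "\<dots> =
          Poly_Mapping.single (u + Poly_Mapping.single i 1) (Poly_Mapping.lookup f u) + g * var i"
        by (simp add: distrib_right var_def mult_single)
      finally have "f * var i =
          Poly_Mapping.single (u + Poly_Mapping.single i 1) (Poly_Mapping.lookup f u) + g * var i" .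
      moreover have "Poly_Mapping.lookup (g * var i) (u + Poly_Mapping.single i 1) = 0"
        using keys_mult[of g "var i"]
        by (auto simp: g_def var_def in_keys_iff lookup_restrict_keys split: if_splits)
      ultimately have "Poly_Mapping.lookup f u = 0"
        using zero by (simp add: lookup_add)
      with u show False by (simp add: in_keys_iff)
    qed
    then show ?thesis by (simp add: f(2) zero_quot_ring)
  qed
  moreover have "\<zero>\<^bsub>quot_ring I\<^esub> \<in> socle (I :: ('n, 'k) mpoly set) \<inter> graded_part I d"
  proof
    have "irrelevant_ideal (I :: ('n, 'k) mpoly set) \<subseteq> carrier (quot_ring I)"
      unfolding irrelevant_ideal_def
      by (rule ideal.Icarr[OF Q.genideal_ideal, THEN subsetI]) (auto simp: carrier_quot_ring)
    then show "\<zero>\<^bsub>quot_ring I\<^esub> \<in> socle (I :: ('n, 'k) mpoly set)"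
      by (auto simp: socle_def)
    show "\<zero>\<^bsub>quot_ring I\<^esub> \<in> graded_part (I :: ('n, 'k) mpoly set) d"
      unfolding graded_part_I zero_quot_ring by (intro imageI) simp
  qed
  ultimately show "socle (I :: ('n, 'k) mpoly set) \<inter> graded_part I d = {\<zero>\<^bsub>quot_ring I\<^esub>}" by blast
qed

end

subsection \<open>Counting monomials\<close>

text \<open>
  Exponents of the monomials of degree \<open>d\<close> dividing a generator of the inverse system. The
  generators are, with \<open>e = 12 m - 3\<close>, the monomials \<open>x\<^sup>p y\<^sup>q z\<^sup>r\<close> of degree \<open>e\<close> with
  \<open>p < 3 m\<close> and \<open>p + q \<le> e - 3 \<lfloor>p/3\<rfloor>\<close>, together with \<open>x\<close>, \<open>y\<close>, \<open>z\<close> to the powers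
  \<open>6 m - 1\<close>, \<open>3 m - 1\<close>, \<open>3 m - 1\<close>.
\<close>

definition stair :: "nat \<Rightarrow> nat \<Rightarrow> (nat \<times> nat \<times> nat) set"
  where "stair m d = {(p, q, r). p + q + r = d \<and> d \<le> 12 * m - 3 \<and>
    (p < 3 * m \<and> p + q + 3 * (p div 3) \<le> 12 * m - 3 \<or> p < 6 * m \<and> q < 3 * m \<and> r < 3 * m)}"

text \<open>
  Multiplication by \<open>z\<close> maps degree \<open>d\<close> to degree \<open>d + 1\<close>; it misses exactly the monomials
  of \<open>stair_bottom m (d + 1)\<close>, and those of \<open>stair_top m d\<close> are the ones it moves out.
\<close>

definition stair_bottom :: "nat \<Rightarrow> nat \<Rightarrow> (nat \<times> nat) set"
  where "stair_bottom m d = {(p, q). (p, q, 0) \<in> stair m d}"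

definition stair_top :: "nat \<Rightarrow> nat \<Rightarrow> (nat \<times> nat) set"
  where "stair_top m d =
    {(p, q). p + q + (3 * m - 1) = d \<and> 3 * m \<le> p \<and> p < 6 * m \<and> q < 3 * m}"

lemma finite_stair [simp]: "finite (stair m d)"
  by (rule finite_subset[of _ "{..d} \<times> {..d} \<times> {..d}"]) (auto simp: stair_def)

lemma finite_stair_bottom [simp]: "finite (stair_bottom m d)"
  by (rule finite_subset[of _ "{..d} \<times> {..d}"]) (auto simp: stair_bottom_def stair_def)

lemma finite_stair_top [simp]: "finite (stair_top m d)"
  by (rule finite_subset[of _ "{..d} \<times> {..d}"]) (auto simp: stair_top_def)

text \<open>Degree \<open>d + 1\<close> splits into the image of multiplication by \<open>z\<close>
  and the monomials free of \<open>z\<close>. The balance is written with sums to avoid truncated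
  subtraction.\<close>

lemma card_stair_Suc:
  assumes "m > 0" "d < 12 * m - 3"
  shows "card (stair m (Suc d)) + card (stair_top m d) =
    card (stair m d) + card (stair_bottom m (Suc d))"
proof -
  define T where "T = (\<lambda>(p, q). (p, q, 3 * m - 1)) ` stair_top m d"
  define up where "up = (\<lambda>(p, q, r). (p, q, Suc r)) ` (stair m d - T)"
  define B where "B = (\<lambda>(p, q). (p, q, 0::nat)) ` stair_bottom m (Suc d)"
  have "stair m (Suc d) \<subseteq> up \<union> B"
  proof (clarify)
    fix p q r assume pqr: "(p, q, r) \<in> stair m (Suc d)" "(p, q, r) \<notin> B"
    then obtain s where s: "r = Suc s"
      by (cases r) (auto simp: B_def stair_bottom_def image_iff)
    with pqr(1) have "(p, q, s) \<in> stair m d - T"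
      using assms by (auto simp: T_def stair_top_def stair_def)
    then show "(p, q, r) \<in> up" unfolding up_def s by force
  qed
  moreover have "up \<subseteq> stair m (Suc d)"
  proof -
    have "(p, q, Suc r) \<in> stair m (Suc d)" if "(p, q, r) \<in> stair m d" "(p, q, r) \<notin> T" for p q r
    proof (cases "p < 3 * m")
      case True
      \<comment> \<open>For \<open>p < 3 * m\<close> a divisor of the extra generator also meets the
        staircase bound, its left side being at most \<open>9 * m - 5\<close>. The bound does not
        involve \<open>r\<close>, so multiplication by \<open>z\<close> stays inside.\<close>
      then have "p + q + 3 * (p div 3) \<le> 12 * m - 3"
        using that(1) assms by (auto simp: stair_def)
      with True show ?thesis using that(1) assms by (auto simp: stair_def)
    next
      case False
      with that(1) have pqr: "p + q + r = d" "p < 6 * m" "q < 3 * m" "r < 3 * m"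
        by (auto simp: stair_def)
      have "r \<noteq> 3 * m - 1"
      proof
        assume "r = 3 * m - 1"
        with pqr False have "(p, q) \<in> stair_top m d" by (auto simp: stair_top_def)
        then have "(p, q, r) \<in> T" unfolding T_def \<open>r = 3 * m - 1\<close> by force
        with that(2) show False by simp
      qed
      with pqr show ?thesis using assms by (auto simp: stair_def)
    qed
    then show ?thesis by (auto simp: up_def)
  qed
  moreover have "B \<subseteq> stair m (Suc d)" by (auto simp: B_def stair_bottom_def)
  ultimately have "stair m (Suc d) = up \<union> B" by blast
  moreover have "up \<inter> B = {}" by (auto simp: up_def B_def)
  ultimately have "card (stair m (Suc d)) = card up + card B"
    by (simp add: card_Un_disjoint up_def B_def)
  moreover have "card up = card (stair m d - T)"
    unfolding up_def by (rule card_image) (auto simp: inj_on_def)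
  moreover have "card B = card (stair_bottom m (Suc d))"
    unfolding B_def by (rule card_image) (auto simp: inj_on_def)
  moreover have "card T = card (stair_top m d)"
    unfolding T_def by (rule card_image) (auto simp: inj_on_def)
  moreover have "T \<subseteq> stair m d"
    using assms by (auto simp: T_def stair_top_def stair_def)
  then have "card (stair m d - T) + card T = card (stair m d)"
    by (metis card_Diff_subset card_mono finite_stair finite_subset le_add_diff_inverse2)
  ultimately show ?thesis by linarith
qed

text \<open>The range stops where the last \<open>3 * m\<close> degrees begin. At most one monomial
  is moved out for each \<open>p\<close> in \<open>{3 * m..<6 * m}\<close>; if there are any, one
  new monomial appears for each \<open>p < 3 * m\<close>.\<close>

lemma card_stair_mono:
  assumes "m > 0" "d < 9 * m - 2"
  shows "card (stair m d) \<le> card (stair m (Suc d))"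
proof -
  have "card (stair_top m d) \<le> card (stair_bottom m (Suc d))"
  \<comment> \<open>The least degree of a monomial that is moved out is
    \<open>3 * m + (3 * m - 1)\<close>.\<close>
  proof (cases "6 * m - 1 \<le> d")
    case False
    then have "stair_top m d = {}" using assms by (auto simp: stair_top_def)
    then show ?thesis by simp
  next
    case True
    have "card (stair_top m d) = card (fst ` stair_top m d)"
      by (rule card_image[symmetric]) (auto simp: inj_on_def stair_top_def)
    also have "\<dots> \<le> card {3 * m..<6 * m}"
      by (rule card_mono) (auto simp: stair_top_def)
    also have "\<dots> = card ((\<lambda>p. (p, Suc d - p)) ` {..<3 * m})"
      by (subst card_image) (auto simp: inj_on_def)
    also have "\<dots> \<le> card (stair_bottom m (Suc d))"
    proof (rule card_mono)
      \<comment> \<open>Hence \<open>Suc d + 3 * (p div 3)\<close> is at most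
        \<open>(9 * m - 2) + (3 * m - 3)\<close>, within the staircase bound.\<close>
      have "3 * (p div 3) \<le> 3 * m - 3" if "p < 3 * m" for p using that by presburger
      then show "(\<lambda>p. (p, Suc d - p)) ` {..<3 * m} \<subseteq> stair_bottom m (Suc d)"
        using assms True by (fastforce simp: stair_bottom_def stair_def)
    qed simp
    finally show ?thesis .
  qed
  with card_stair_Suc[of m d] assms show ?thesis by linarith
qed

text \<open>Here \<open>j\<close> is the distance from the socle degree. One degree further down,
  \<open>j div 3 + 1\<close> stairs of width 3 are lost and \<open>j + 2\<close> divisors of the
  extra generator are gained.\<close>

lemma card_stair_drop:
  assumes "m > 0" "j < 3 * m - 1"
  shows "card (stair m (12 * m - 3 - j)) + (j + 2) =
    card (stair m (12 * m - 3 - Suc j)) + 3 * (j div 3 + 1)"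
proof -
  define d where "d = 12 * m - 3 - Suc j"
  have d: "Suc d = 12 * m - 3 - j" "d + Suc j + 3 = 12 * m" "d < 12 * m - 3"
    using assms by (auto simp: d_def)
  have "stair_bottom m (Suc d) = (\<lambda>p. (p, Suc d - p)) ` {..<3 * (j div 3) + 3}"
  proof -
    \<comment> \<open>Without \<open>z\<close>, a divisor of the extra generator has degree at most
      \<open>9 * m - 2\<close>, less than \<open>Suc d\<close>, so only the staircase condition
      remains.\<close>
    have "(p, q) \<in> stair_bottom m (Suc d) \<longleftrightarrow> p + q = Suc d \<and> p < 3 * m \<and> 3 * (p div 3) \<le> j" for p q
      using assms d by (auto simp: stair_bottom_def stair_def)
    moreover have "p < 3 * m \<and> 3 * (p div 3) \<le> j \<longleftrightarrow> p < 3 * (j div 3) + 3" for p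
    proof -
      have "j div 3 < m" using assms by (simp add: div_less_iff_less_mult)
      then have "3 * (j div 3) + 3 \<le> 3 * m" by linarith
      moreover have "3 * (p div 3) \<le> j \<longleftrightarrow> p div 3 < j div 3 + 1"
        by (simp add: less_eq_div_iff_mult_less_eq mult.commute less_Suc_eq_le)
      moreover have "p div 3 < j div 3 + 1 \<longleftrightarrow> p < 3 * (j div 3) + 3"
        by (simp only: div_less_iff_less_mult zero_less_numeral) (simp add: algebra_simps)
      ultimately show ?thesis by linarith
    qed
    moreover have "p \<le> Suc d" if "p < 3 * m" for p
      using that d assms by linarith
    ultimately have "(p, q) \<in> stair_bottom m (Suc d) \<longleftrightarrow> p < 3 * (j div 3) + 3 \<and> q = Suc d - p" for p q
      by (metis add_diff_cancel_left' le_add_diff_inverse)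
    then show ?thesis by auto
  qed
  then have bottom: "card (stair_bottom m (Suc d)) = 3 * (j div 3 + 1)"
    by (simp add: card_image inj_on_def)
  \<comment> \<open>The cofactor in the extra generator is free of \<open>z\<close> and has degree
    \<open>Suc j\<close>; \<open>s\<close> is its exponent of \<open>x\<close>.\<close>
  have "stair_top m d = (\<lambda>s. (6 * m - 1 - s, 3 * m - 2 - j + s)) ` {..Suc j}"
  proof (intro equalityI subsetI)
    fix x assume "x \<in> stair_top m d"
    then obtain p q where x: "x = (p, q)" "p + q + (3 * m - 1) = d" "3 * m \<le> p" "p < 6 * m" "q < 3 * m"
      by (auto simp: stair_top_def)
    then show "x \<in> (\<lambda>s. (6 * m - 1 - s, 3 * m - 2 - j + s)) ` {..Suc j}"
      using d assms by (intro image_eqI[of _ _ "6 * m - 1 - p"]) auto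
  qed (use d assms in \<open>auto simp: stair_top_def\<close>)
  moreover have "inj_on (\<lambda>s. (6 * m - 1 - s, 3 * m - 2 - j + s)) {..Suc j}"
    by (auto simp: inj_on_def)
  ultimately have "card (stair_top m d) = j + 2"
    by (simp add: card_image)
  with bottom card_stair_Suc[OF assms(1) d(3)] show ?thesis
    unfolding d(1)[symmetric] d_def[symmetric] by linarith
qed

text \<open>By \<open>card_stair_drop\<close>, passing from \<open>j\<close> to \<open>Suc j\<close>
  changes the count by \<open>j + 2 - 3 * (j div 3 + 1) = j mod 3 - 1\<close>. The changes -1, 0, 1
  cancel over three steps.\<close>

lemma card_stair_tail:
  assumes "m > 0" "j < 3 * m"
  shows "card (stair m (12 * m - 3 - j)) + 1 =
    card (stair m (12 * m - 3)) + (if j mod 3 = 0 then 1 else 0)"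
  using assms(2)
proof (induction j)
  case (Suc j)
  have "3 * (j div 3) + j mod 3 = j" by simp
  moreover have "j mod 3 = 0 \<and> Suc j mod 3 = 1 \<or> j mod 3 = 1 \<and> Suc j mod 3 = 2 \<or>
      j mod 3 = 2 \<and> Suc j mod 3 = 0" by presburger
  moreover have "card (stair m (12 * m - 3 - j)) + (j + 2) =
      card (stair m (12 * m - 3 - Suc j)) + 3 * (j div 3 + 1)"
    using Suc.prems by (intro card_stair_drop assms) simp
  moreover have "card (stair m (12 * m - 3 - j)) + 1 =
      card (stair m (12 * m - 3)) + (if j mod 3 = 0 then 1 else 0)"
    using Suc by simp
  ultimately show ?case
    by (elim disjE conjE) simp_all
qed simp

section \<open>Lists ending in a repeated block and their maxima\<close>

definition repeats_block :: "nat \<Rightarrow> nat \<Rightarrow> nat list \<Rightarrow> bool"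
  where "repeats_block t s h \<longleftrightarrow> (\<forall>i. s + i < length h \<longrightarrow>
     h ! (s + i) = t + (if i mod 3 = 2 then 1 else 0))"

lemma concat_replicate_block:
  fixes t :: nat
  shows "concat (replicate m [t, t, t + 1]) = map (\<lambda>i. t + (if i mod 3 = 2 then 1 else 0)) [0..<3 * m]"
proof (induction m)
  case (Suc m)
  have "[0..<3 * Suc m] = [0..<3 * m] @ [3 * m, 3 * m + 1, 3 * m + 2]"
    using upt_add_eq_append[of 0 "3 * m" 3] by (simp add: numeral_3_eq_3)
  moreover have "Suc (Suc (3 * m)) mod 3 = 2" "Suc (3 * m) mod 3 = 1" by presburger+
  ultimately show ?case
    using Suc by (simp add: replicate_append_same[symmetric] del: upt_Suc)
qed simp

lemma suffix_block:
  assumes "length h = s + 3 * m" "repeats_block t s h"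
  shows "suffix (concat (replicate m [t, t, t + 1])) h"
proof -
  have "drop s h = map (\<lambda>i. t + (if i mod 3 = 2 then 1 else 0)) [0..<3 * m]"
    using assms by (intro nth_equalityI) (auto simp: repeats_block_def)
  then show ?thesis
    unfolding concat_replicate_block by (metis suffix_drop)
qed

text \<open>No maximum ends before position \<open>s\<close>, since the list neither drops nor stops
  there. In the tail the entries \<open>t + 1\<close> are isolated, and each of the \<open>m\<close>
  blocks contains one.\<close>

lemma card_maxima:
  assumes "m > 0" and len: "length h = s + 3 * m"
    and mono: "\<And>i. i < s \<Longrightarrow> h ! i \<le> h ! Suc i"
    and block: "repeats_block t s h"
  shows "card (maxima h) = m"
proof -
  let ?f = "\<lambda>k. (s + 3 * k + 2, s + 3 * k + 2)"
  have nth: "h ! (s + i) = t + (if i mod 3 = 2 then 1 else 0)" if "i < 3 * m" for i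
    using block len that by (simp add: repeats_block_def)
  have "maxima h = ?f ` {..<m}"
  proof (intro equalityI subsetI)
    fix x assume "x \<in> maxima h"
    then obtain i j where x: "x = (i, j)" "i \<le> j" "j < s + 3 * m"
      "\<forall>l\<in>{i..j}. h ! l = h ! i" "Suc j < s + 3 * m \<longrightarrow> h ! Suc j < h ! j"
      unfolding maxima_def len by blast
    have "\<not> j < s"
    proof
      assume "j < s"
      moreover from this have "Suc j < s + 3 * m" using \<open>m > 0\<close> by linarith
      ultimately show False using x(5) mono[of j] by simp
    qed
    then obtain a where a: "j = s + a" using le_Suc_ex not_less by blast
    with x(3) have "a < 3 * m" by simp
    have a2: "a mod 3 = 2"
    proof (cases "Suc a < 3 * m")
      case True
      then show ?thesis
        using x(5) nth[of a] nth[of "Suc a"] \<open>a < 3 * m\<close> by (auto simp: a split: if_splits)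
    next
      \<comment> \<open>The final entry has no successor to descend to, but there
        \<open>a = 3 * m - 1\<close>, which is 2 modulo 3.\<close>
      case False
      with \<open>a < 3 * m\<close> show ?thesis by presburger
    qed
    then have b: "a = 3 * (a div 3) + 2" by (metis mult_div_mod_eq)
    with \<open>a < 3 * m\<close> have "a div 3 < m" by linarith
    \<comment> \<open>A longer block would contain \<open>j - 1\<close>, where the entry is
      \<open>t\<close> and not \<open>t + 1\<close>.\<close>
    have "\<not> i < j"
    proof
      assume "i < j"
      then have "h ! (j - 1) = h ! j" using bspec[OF x(4), of "j - 1"] bspec[OF x(4), of j] by simp
      moreover have "a - 1 = 3 * (a div 3) + 1" "a > 0" using b by linarith+
      then have "(a - 1) mod 3 = 1" by (metis Suc_eq_plus1 Suc_times_numeral_mod_eq numeral_eq_one_iff semiring_norm(86))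
      ultimately show False
        using nth[of a] nth[OF less_imp_diff_less, of a 1] a2 \<open>a < 3 * m\<close> \<open>a > 0\<close>
        by (simp add: a)
    qed
    with x(2) have "i = j" by simp
    then show "x \<in> ?f ` {..<m}"
      using b \<open>a div 3 < m\<close> unfolding x(1) a by (intro image_eqI[of _ _ "a div 3"]) simp_all
  next
    fix x assume "x \<in> ?f ` {..<m}"
    then obtain k where k: "k < m" "x = ?f k" by auto
    have mods: "(3 * k + 1) mod 3 = 1" "(3 * k + 2) mod 3 = 2" "(3 * k + 3) mod 3 = 0"
      using mod_mult_self4[of 3 k 1] mod_mult_self4[of 3 k 2] mod_mult_self4[of 3 k 3] by simp_all
    define j where "j = s + 3 * k + 2"
    have j: "j = s + (3 * k + 2)" "j - 1 = s + (3 * k + 1)" "Suc j = s + (3 * k + 3)"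
      by (simp_all add: j_def)
    have "h ! j = t + 1" unfolding j(1) using nth[of "3 * k + 2"] k(1) mods(2) by simp
    moreover have "h ! (j - 1) = t" unfolding j(2) using nth[of "3 * k + 1"] k(1) mods(1) by simp
    moreover have "h ! Suc j = t" if "Suc j < length h"
      using that nth[of "3 * k + 3"] mods(3) unfolding j(3) len by simp
    moreover have "j < length h" using k(1) by (simp add: j_def len)
    ultimately show "x \<in> maxima h"
      unfolding k(2) j_def[symmetric] maxima_def by auto
  qed
  then have "card (maxima h) = card (?f ` {..<m})" by (rule arg_cong)
  also have "\<dots> = card {..<m}" by (rule card_image) (auto simp: inj_on_def)
  also have "\<dots> = m" by (rule card_lessThan)
  finally show ?thesis .
qed

subsection \<open>Level algebras of codimension three\<close>

lemma UNIV_three: "(UNIV :: 3 set) = {0, 1, 2}"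
proof -
  have "card {0, 1, 2 :: 3} = card (UNIV :: 3 set)" by simp
  then show ?thesis by (metis card_subset_eq finite subset_UNIV)
qed

lemma mdeg_three: "mdeg (u :: 3 \<Rightarrow>\<^sub>0 nat) =
    Poly_Mapping.lookup u 0 + Poly_Mapping.lookup u 1 + Poly_Mapping.lookup u 2"
  unfolding mdeg_def UNIV_three by simp

section \<open>Exponent triples as monomials in three variables\<close>

definition exponents :: "nat \<times> nat \<times> nat \<Rightarrow> 3 \<Rightarrow>\<^sub>0 nat"
  where "exponents = (\<lambda>(p, q, r). Poly_Mapping.single 0 p + Poly_Mapping.single 1 q + Poly_Mapping.single 2 r)"

lemma lookup_exponents [simp]:
  "Poly_Mapping.lookup (exponents (p, q, r)) 0 = p"
  "Poly_Mapping.lookup (exponents (p, q, r)) 1 = q"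
  "Poly_Mapping.lookup (exponents (p, q, r)) 2 = r"
  by (simp_all add: exponents_def lookup_add lookup_single)

lemma exponents_lookup:
  "exponents (Poly_Mapping.lookup u 0, Poly_Mapping.lookup u 1, Poly_Mapping.lookup u 2) = u"
proof (rule poly_mapping_eqI)
  fix i :: 3
  have "i \<in> {0, 1, 2}" using UNIV_three by blast
  then show "Poly_Mapping.lookup (exponents (Poly_Mapping.lookup u 0, Poly_Mapping.lookup u 1,
      Poly_Mapping.lookup u 2)) i = Poly_Mapping.lookup u i"
    by auto
qed

lemma inj_exponents: "inj exponents"
  by (rule inj_on_inverseI[of _ "\<lambda>u. (Poly_Mapping.lookup u 0, Poly_Mapping.lookup u 1,
      Poly_Mapping.lookup u 2)"]) auto

definition stair_monomials :: "nat \<Rightarrow> (3 \<Rightarrow>\<^sub>0 nat) set"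
  where "stair_monomials m = {u.
    (Poly_Mapping.lookup u 0, Poly_Mapping.lookup u 1, Poly_Mapping.lookup u 2) \<in> stair m (mdeg u)}"

lemma stair_monomials_degree: "{u \<in> stair_monomials m. mdeg u = d} = exponents ` stair m d"
proof (intro equalityI subsetI)
  fix u assume "u \<in> {u \<in> stair_monomials m. mdeg u = d}"
  then show "u \<in> exponents ` stair m d"
    by (intro image_eqI[where f = exponents, OF exponents_lookup[symmetric]])
      (auto simp: stair_monomials_def)
next
  fix u assume "u \<in> exponents ` stair m d"
  then obtain p q r where "u = exponents (p, q, r)" "(p, q, r) \<in> stair m d" by auto
  moreover from this have "p + q + r = d" by (simp add: stair_def)
  ultimately show "u \<in> {u \<in> stair_monomials m. mdeg u = d}"
    by (simp add: stair_monomials_def mdeg_three)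
qed

lemma card_stair_monomials_degree: "card {u \<in> stair_monomials m. mdeg u = d} = card (stair m d)"
  unfolding stair_monomials_degree by (rule card_image) (rule inj_on_subset[OF inj_exponents subset_UNIV])

lemma stair_down_closed:
  assumes "(p + p', q + q', r + r') \<in> stair m d"
  shows "(p, q, r) \<in> stair m (p + q + r)"
proof -
  have "p div 3 \<le> (p + p') div 3" by (rule div_le_mono) simp
  then show ?thesis using assms by (auto simp: stair_def)
qed

lemma finite_order_ideal_stair: "finite_order_ideal (stair_monomials m)"
proof
  have "stair_monomials m \<subseteq> (\<Union>d\<le>12 * m - 3. {u \<in> stair_monomials m. mdeg u = d})"
    by (auto simp: stair_monomials_def stair_def)
  then show "finite (stair_monomials m)"
    by (rule finite_subset) (simp add: stair_monomials_degree)
  show "u \<in> stair_monomials m" if "u + v \<in> stair_monomials m" for u v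
    using that by (auto simp: stair_monomials_def mdeg_three lookup_add dest: stair_down_closed)
qed

text \<open>If \<open>p < 3 * m\<close>, the staircase bound holds and leaves \<open>r\<close> free
  to grow. Otherwise the monomial properly divides the extra generator, whose degree is
  \<open>12 * m - 3\<close>, so some exponent can still grow.\<close>

lemma stair_extend:
  assumes "(p, q, r) \<in> stair m d" "d < 12 * m - 3"
  shows "(Suc p, q, r) \<in> stair m (Suc d) \<or> (p, Suc q, r) \<in> stair m (Suc d) \<or>
    (p, q, Suc r) \<in> stair m (Suc d)"
proof (cases "p < 3 * m")
  case True
  have "3 * (p div 3) \<le> p" by simp
  with True assms show ?thesis by (auto simp: stair_def)
next
  case False
  with assms show ?thesis by (auto simp: stair_def)
qed

lemma stair_monomials_extend:
  assumes "u \<in> stair_monomials m" "mdeg u < 12 * m - 3"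
  shows "\<exists>i. u + Poly_Mapping.single i 1 \<in> stair_monomials m"
proof -
  let ?p = "Poly_Mapping.lookup u 0" and ?q = "Poly_Mapping.lookup u 1"
    and ?r = "Poly_Mapping.lookup u 2"
  have "u + Poly_Mapping.single 0 1 \<in> stair_monomials m \<longleftrightarrow> (Suc ?p, ?q, ?r) \<in> stair m (Suc (mdeg u))"
    "u + Poly_Mapping.single 1 1 \<in> stair_monomials m \<longleftrightarrow> (?p, Suc ?q, ?r) \<in> stair m (Suc (mdeg u))"
    "u + Poly_Mapping.single 2 1 \<in> stair_monomials m \<longleftrightarrow> (?p, ?q, Suc ?r) \<in> stair m (Suc (mdeg u))"
    by (simp_all add: stair_monomials_def mdeg_three lookup_add lookup_single)
  moreover have "(?p, ?q, ?r) \<in> stair m (mdeg u)"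
    using assms(1) by (simp add: stair_monomials_def)
  ultimately show ?thesis
    using stair_extend[OF _ assms(2)] by blast
qed

lemma stair_level_algebra:
  assumes "m > 0"
  defines "J \<equiv> monomial_complement_ideal (stair_monomials m) :: (3, 'k::field) mpoly set"
  shows level_algebra_stair: "level_algebra J"
    and codimension_stair: "codimension J = 3"
    and h_vector_stair: "h_vector J = map (\<lambda>d. card (stair m d)) [0..<12 * m - 2]"
proof -
  interpret finite_order_ideal "stair_monomials m" by (rule finite_order_ideal_stair)
  have low: "u \<in> stair_monomials m" if "mdeg u \<le> 1" for u
  proof -
    have "3 * (Poly_Mapping.lookup u 0 div 3) \<le> Poly_Mapping.lookup u 0" by simp
    with that assms(1) show ?thesis
      by (auto simp: stair_monomials_def stair_def mdeg_three)
  qed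
  have "0 \<in> stair_monomials m" by (rule low) (simp add: mdeg_def)
  then have hilbert: "hilbert_fun J d = card (stair m d)" for d
    unfolding J_def by (subst hilbert_fun_I) (auto simp: card_stair_monomials_degree)
  have socle: "socle_degree J = 12 * m - 3"
    unfolding socle_degree_def
  proof (rule Greatest_equality)
    have "(6 * m - 1, 3 * m - 1, 3 * m - 1) \<in> stair m (12 * m - 3)"
      using assms(1) by (auto simp: stair_def)
    then show "hilbert_fun J (12 * m - 3) > 0"
      unfolding hilbert card_gt_0_iff by auto
    show "d \<le> 12 * m - 3" if "hilbert_fun J d > 0" for d
      using that by (auto simp: hilbert card_gt_0_iff stair_def)
  qed
  show "level_algebra J"
    unfolding J_def by (rule level_algebra_I[OF low stair_monomials_extend])
      (simp_all add: socle[unfolded J_def])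
  have "stair m 1 = {(1, 0, 0), (0, 1, 0), (0, 0, 1)}"
  proof (intro equalityI subsetI)
    fix x assume "x \<in> stair m 1"
    then obtain p q r where "x = (p, q, r)" "p + q + r = 1" by (auto simp: stair_def)
    then show "x \<in> {(1, 0, 0), (0, 1, 0), (0, 0, 1)}" by (cases p; cases q; cases r) auto
  qed (use assms(1) in \<open>auto simp: stair_def\<close>)
  then show "codimension J = 3" by (simp add: codimension_def hilbert)
  have "Suc (12 * m - 3) = 12 * m - 2" using assms(1) by simp
  then show "h_vector J = map (\<lambda>d. card (stair m d)) [0..<12 * m - 2]"
    unfolding h_vector_def socle by (simp add: hilbert del: upt_Suc)
qed

lemma stair_repeats_block:
  assumes "m > 0"
  obtains t where "t > 0"
    "repeats_block t (9 * m - 2) (map (\<lambda>d. card (stair m d)) [0..<12 * m - 2])"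
proof
  \<comment> \<open>One below the socle degree the count has its lower value, since
    \<open>j = 1\<close> is not divisible by 3.\<close>
  define t where "t = card (stair m (12 * m - 3 - 1))"
  have "(0, 0, 12 * m - 3 - 1) \<in> stair m (12 * m - 3 - 1)" using assms by (auto simp: stair_def)
  then show "t > 0" unfolding t_def card_gt_0_iff by auto
  have total: "card (stair m (12 * m - 3)) = t + 1"
    using card_stair_tail[OF assms, of 1] assms by (simp add: t_def)
  have "card (stair m (9 * m - 2 + i)) = t + (if i mod 3 = 2 then 1 else 0)" if "i < 3 * m" for i
  proof -
    \<comment> \<open>This turns the position \<open>i\<close> within the tail into the distance
      from the socle degree; as \<open>i + j + 1 = 3 * m\<close>, residue 2 for \<open>i\<close>
      means residue 0 for \<open>j\<close>.\<close>
    define j where "j = 3 * m - 1 - i"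
    with that have j: "3 * m = i + j + 1" by simp
    have "(i mod 3 = 2) = (j mod 3 = 0)" using j by presburger
    moreover have "9 * m - 2 + i = 12 * m - 3 - j" using j assms by linarith
    ultimately show ?thesis using card_stair_tail[OF assms, of j] j total by simp
  qed
  then show "repeats_block t (9 * m - 2) (map (\<lambda>d. card (stair m d)) [0..<12 * m - 2])"
    using assms by (simp add: repeats_block_def del: upt_Suc)
qed

theorem mainTheorem4:
  shows "(\<forall>N::nat. N > 0 \<longrightarrow>
            (\<exists>I :: (3, 'k::field_char_0) mpoly set.
               level_algebra I \<and> codimension I = 3 \<and> card (maxima (h_vector I)) = N)) \<and>
         (\<forall>m::nat. m > 0 \<longrightarrow>
            (\<exists>t::nat. t > 0 \<and>
               (\<exists>I :: (3, 'k) mpoly set.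
                  level_algebra I \<and> codimension I = 3 \<and>
                  suffix (concat (replicate m [t, t, t + 1])) (h_vector I))))"
proof (intro conjI allI impI)
  fix N :: nat assume N: "N > 0"
  \<comment> \<open>Taking \<open>N\<close> itself as the staircase parameter gives one peak for
    each of the \<open>N\<close> blocks.\<close>
  let ?h = "map (\<lambda>d. card (stair N d)) [0..<12 * N - 2]"
  obtain t where block: "repeats_block t (9 * N - 2) ?h" using stair_repeats_block[OF N] by blast
  have "?h ! i \<le> ?h ! Suc i" if "i < 9 * N - 2" for i
  proof -
    have "Suc i < 12 * N - 2" using that N by linarith
    with card_stair_mono[OF N that] show ?thesis by simp
  qed
  then have maxima: "card (maxima ?h) = N"
    using N by (intro card_maxima[OF N _ _ block]) auto
  define J :: "(3, 'k) mpoly set" where "J = monomial_complement_ideal (stair_monomials N)"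
  have "level_algebra J" "codimension J = 3" and h: "h_vector J = ?h"
    unfolding J_def by (rule level_algebra_stair codimension_stair h_vector_stair, rule N)+
  moreover have "card (maxima (h_vector J)) = N" unfolding h by (rule maxima)
  ultimately show "\<exists>I :: (3, 'k) mpoly set.
      level_algebra I \<and> codimension I = 3 \<and> card (maxima (h_vector I)) = N" by blast
next
  fix m :: nat assume m: "m > 0"
  let ?h = "map (\<lambda>d. card (stair m d)) [0..<12 * m - 2]"
  obtain t where "t > 0" and block: "repeats_block t (9 * m - 2) ?h"
    using stair_repeats_block[OF m] by blast
  have suffix: "suffix (concat (replicate m [t, t, t + 1])) ?h"
    using m by (intro suffix_block[OF _ block]) simp
  define J :: "(3, 'k) mpoly set" where "J = monomial_complement_ideal (stair_monomials m)"
  have "level_algebra J" "codimension J = 3" and h: "h_vector J = ?h"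
    unfolding J_def by (rule level_algebra_stair codimension_stair h_vector_stair, rule m)+
  moreover have "suffix (concat (replicate m [t, t, t + 1])) (h_vector J)"
    unfolding h by (rule suffix)
  ultimately show "\<exists>t::nat. t > 0 \<and> (\<exists>I :: (3, 'k) mpoly set.
      level_algebra I \<and> codimension I = 3 \<and> suffix (concat (replicate m [t, t, t + 1])) (h_vector I))"
    using \<open>t > 0\<close> by blast
qed

end
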